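(* The quaternion sine function $z\mapsto \sin z$ is $\mathbb{H}$-differentiable at every $z\in\mathbb{H}$, and its $\mathbb{H}$-derivative satisfies $$(\sin z)'=\cos z .$$
   Context: $\mathbb{H}$ denotes the algebra of real quaternions with its usual norm $|\cdot|$. For $z\in\mathbb{H}$, $\sin z=z-\frac{z^3}{3!}+\frac{z^5}{5!}-\cdots$ and $\cos z=1-\frac{z^2}{2!}+\frac{z^4}{4!}-\cdots$. A quaternion function $f$ defined on a neighborhood $G\subset\mathbb{H}$ of a point $z^0$ is called $\mathbb{H}$-differentiable at $z^0$ if there exist two (finite or infinite) sequences of quaternions $A_k=A_k(z^0)$, $B_k=B_k(z^0)$ such that $\sum_k A_kB_k$ is finite (converges) and, for $z^0+h\in G$, $$f(z^0+h)-f(z^0)=\sum_k A_k\, h\, B_k+\omega(z^0,h),\qquad \lim_{h\to0}\frac{|\omega(z^0,h)|}{|h|}=0.$$ In this case the quaternion $f'(z^0)=\sum_k A_kB_k$ is called the $\mathbb{H}$-derivative of $f$ at $z^0$. *)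

theory Defs
  imports "HOL-Analysis.Analysis"
begin

section \<open>The algebra of real quaternions\<close>

datatype quat = Quat (qRe: real) (qI: real) (qJ: real) (qK: real)

lemma quat_eq_iff: "x = y \<longleftrightarrow> qRe x = qRe y \<and> qI x = qI y \<and> qJ x = qJ y \<and> qK x = qK y"
  by (cases x; cases y) auto

instantiation quat :: ab_group_add
begin

definition "0 = Quat 0 0 0 0"
definition "x + y = Quat (qRe x + qRe y) (qI x + qI y) (qJ x + qJ y) (qK x + qK y)"
definition "- x = Quat (- qRe x) (- qI x) (- qJ x) (- qK x)"
definition "x - y = Quat (qRe x - qRe y) (qI x - qI y) (qJ x - qJ y) (qK x - qK y)"

instance
  by standard
    (simp_all add: quat_eq_iff zero_quat_def plus_quat_def uminus_quat_def minus_quat_def)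

end

lemma quat_add_sel [simp]:
  "qRe 0 = 0" "qI 0 = 0" "qJ 0 = 0" "qK 0 = 0"
  "qRe (x + y) = qRe x + qRe y" "qI (x + y) = qI x + qI y"
  "qJ (x + y) = qJ x + qJ y" "qK (x + y) = qK x + qK y"
  "qRe (- x) = - qRe x" "qI (- x) = - qI x" "qJ (- x) = - qJ x" "qK (- x) = - qK x"
  "qRe (x - y) = qRe x - qRe y" "qI (x - y) = qI x - qI y"
  "qJ (x - y) = qJ x - qJ y" "qK (x - y) = qK x - qK y"
  by (simp_all add: zero_quat_def plus_quat_def uminus_quat_def minus_quat_def)

instantiation quat :: ring_1
begin

definition "1 = Quat 1 0 0 0"
definition "x * y = Quat
  (qRe x * qRe y - qI x * qI y - qJ x * qJ y - qK x * qK y)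
  (qRe x * qI y + qI x * qRe y + qJ x * qK y - qK x * qJ y)
  (qRe x * qJ y - qI x * qK y + qJ x * qRe y + qK x * qI y)
  (qRe x * qK y + qI x * qJ y - qJ x * qI y + qK x * qRe y)"

instance
  by standard
    (simp_all add: quat_eq_iff one_quat_def times_quat_def algebra_simps)

end

instantiation quat :: real_algebra_1
begin

definition "scaleR r x = Quat (r * qRe x) (r * qI x) (r * qJ x) (r * qK x)"

instance
  by standard
    (simp_all add: quat_eq_iff scaleR_quat_def times_quat_def algebra_simps)

end

lemma quat_mult_sel [simp]:
  "qRe 1 = 1" "qI 1 = 0" "qJ 1 = 0" "qK 1 = 0"
  "qRe (x * y) = qRe x * qRe y - qI x * qI y - qJ x * qJ y - qK x * qK y"
  "qI (x * y) = qRe x * qI y + qI x * qRe y + qJ x * qK y - qK x * qJ y"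
  "qJ (x * y) = qRe x * qJ y - qI x * qK y + qJ x * qRe y + qK x * qI y"
  "qK (x * y) = qRe x * qK y + qI x * qJ y - qJ x * qI y + qK x * qRe y"
  "qRe (r *\<^sub>R x) = r * qRe x" "qI (r *\<^sub>R x) = r * qI x"
  "qJ (r *\<^sub>R x) = r * qJ x" "qK (r *\<^sub>R x) = r * qK x"
  by (simp_all add: one_quat_def times_quat_def scaleR_quat_def)

lemma quat_units:
  fixes i j k :: quat
  defines "i \<equiv> Quat 0 1 0 0" and "j \<equiv> Quat 0 0 1 0" and "k \<equiv> Quat 0 0 0 1"
  shows "i * i = -1" "j * j = -1" "k * k = -1"
    "i * j = k" "j * k = i" "k * i = j" "j * i = -k" "k * j = -i" "i * k = -j"
  by (simp_all add: quat_eq_iff i_def j_def k_def)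

instantiation quat :: real_inner
begin

definition inner_quat :: "quat \<Rightarrow> quat \<Rightarrow> real"
  where "inner_quat x y = qRe x * qRe y + qI x * qI y + qJ x * qJ y + qK x * qK y"

definition norm_quat :: "quat \<Rightarrow> real"
  where "norm_quat x = sqrt ((qRe x)\<^sup>2 + (qI x)\<^sup>2 + (qJ x)\<^sup>2 + (qK x)\<^sup>2)"

definition sgn_quat :: "quat \<Rightarrow> quat"
  where "sgn_quat x = x /\<^sub>R norm x"

definition dist_quat :: "quat \<Rightarrow> quat \<Rightarrow> real"
  where "dist_quat x y = norm (x - y)"

definition uniformity_quat :: "(quat \<times> quat) filter"
  where "uniformity_quat = (INF e\<in>{0<..}. principal {(x, y). dist x y < e})"

definition open_quat :: "quat set \<Rightarrow> bool"
  where "open_quat U \<longleftrightarrow> (\<forall>x\<in>U. eventually (\<lambda>(x', y). x' = x \<longrightarrow> y \<in> U) uniformity)"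

instance
proof
  fix x y z :: quat and r :: real
  show "inner x y = inner y x"
    by (simp add: inner_quat_def mult.commute)
  show "inner (x + y) z = inner x z + inner y z"
    by (simp add: inner_quat_def algebra_simps)
  show "inner (r *\<^sub>R x) y = r * inner x y"
    by (simp add: inner_quat_def algebra_simps)
  show "0 \<le> inner x x"
    by (simp add: inner_quat_def)
  have "a * a + b * b + c * c + d * d = 0 \<longleftrightarrow> a = 0 \<and> b = 0 \<and> c = 0 \<and> d = 0"
    for a b c d :: real
    by (simp add: add_nonneg_eq_0_iff)
  then show "inner x x = 0 \<longleftrightarrow> x = 0"
    by (simp add: inner_quat_def quat_eq_iff)
  show "norm x = sqrt (inner x x)"
    by (simp add: inner_quat_def norm_quat_def power2_eq_square)
qed (simp_all only: sgn_quat_def dist_quat_def uniformity_quat_def open_quat_def)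

end

lemma norm_quat_mult: "norm (x * y) = norm x * norm (y :: quat)"
  unfolding norm_quat_def real_sqrt_mult [symmetric]
  by (rule arg_cong [where f = sqrt]) (simp add: power2_eq_square algebra_simps)

instance quat :: real_normed_algebra_1
  by standard (simp_all add: norm_quat_mult norm_quat_def [of 1])

lemma quat_sel_bounded_linear:
  "bounded_linear qRe" "bounded_linear qI" "bounded_linear qJ" "bounded_linear qK"
  by (rule bounded_linear_intro [where K = 1];
      simp add: norm_quat_def real_le_rsqrt algebra_simps flip: real_sqrt_abs)+

lemma quat_decomp:
  "x = qRe x *\<^sub>R Quat 1 0 0 0 + qI x *\<^sub>R Quat 0 1 0 0
     + qJ x *\<^sub>R Quat 0 0 1 0 + qK x *\<^sub>R Quat 0 0 0 1"
  by (simp add: quat_eq_iff)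

instance quat :: banach
proof
  fix X :: "nat \<Rightarrow> quat"
  assume X: "Cauchy X"
  have "convergent (\<lambda>n. f (X n))" if "bounded_linear f" for f :: "quat \<Rightarrow> real"
    using bounded_linear.Cauchy [OF that X] Cauchy_convergent by blast
  note this [unfolded convergent_def, OF quat_sel_bounded_linear(1)]
    this [unfolded convergent_def, OF quat_sel_bounded_linear(2)]
    this [unfolded convergent_def, OF quat_sel_bounded_linear(3)]
    this [unfolded convergent_def, OF quat_sel_bounded_linear(4)]
  then obtain a b c d
    where lims: "(\<lambda>n. qRe (X n)) \<longlonglongrightarrow> a" "(\<lambda>n. qI (X n)) \<longlonglongrightarrow> b"
      "(\<lambda>n. qJ (X n)) \<longlonglongrightarrow> c" "(\<lambda>n. qK (X n)) \<longlonglongrightarrow> d"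
    by blast
  have "(\<lambda>n. qRe (X n) *\<^sub>R Quat 1 0 0 0 + qI (X n) *\<^sub>R Quat 0 1 0 0
     + qJ (X n) *\<^sub>R Quat 0 0 1 0 + qK (X n) *\<^sub>R Quat 0 0 0 1) \<longlonglongrightarrow> a *\<^sub>R Quat 1 0 0 0 + b *\<^sub>R Quat 0 1 0 0
     + c *\<^sub>R Quat 0 0 1 0 + d *\<^sub>R Quat 0 0 0 1"
    by (intro tendsto_intros lims)
  then show "convergent X"
    unfolding quat_decomp [symmetric] by (rule convergentI)
qed

text \<open>
  The library defines \<^const>\<open>sin\<close> and \<^const>\<open>cos\<close> by their power series
  \<open>\<Sum>n. sin_coeff n *\<^sub>R z ^ n\<close> and \<open>\<Sum>n. cos_coeff n *\<^sub>R z ^ n\<close> in every real Banach algebra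
  with unit, so the instances above make them available on \<^typ>\<open>quat\<close>.
\<close>


section \<open>Quaternion differentiability\<close>

text \<open>
  A finite sequence \<open>A\<^sub>k, B\<^sub>k\<close> is encoded by padding with zeros. The expansion of the increment
  is required for every \<open>h\<close> with \<open>z0 + h \<in> G\<close>; in particular the series \<open>\<Sum>k. A\<^sub>k h B\<^sub>k\<close>
  converges for these \<open>h\<close>. The remainder \<open>\<omega>\<close> is determined by the other data on this set;
  its values elsewhere are irrelevant for the limit because \<open>G\<close> is a neighbourhood of \<open>z0\<close>.
\<close>

definition has_H_derivative ::
    "(quat \<Rightarrow> quat) \<Rightarrow> quat set \<Rightarrow> quat \<Rightarrow> quat \<Rightarrow> bool"
  where "has_H_derivative f G z0 D \<longleftrightarrow>
    z0 \<in> interior G \<and>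
    (\<exists>A B :: nat \<Rightarrow> quat. (\<lambda>k. A k * B k) sums D \<and>
      (\<exists>\<omega>. (\<forall>h. z0 + h \<in> G \<longrightarrow>
              summable (\<lambda>k. A k * h * B k) \<and>
              f (z0 + h) - f z0 = (\<Sum>k. A k * h * B k) + \<omega> h) \<and>
           ((\<lambda>h. norm (\<omega> h) / norm h) \<longlongrightarrow> 0) (at 0)))"

definition H_differentiable :: "(quat \<Rightarrow> quat) \<Rightarrow> quat set \<Rightarrow> quat \<Rightarrow> bool"
  where "H_differentiable f G z0 \<longleftrightarrow> (\<exists>D. has_H_derivative f G z0 D)"

definition H_derivative :: "(quat \<Rightarrow> quat) \<Rightarrow> quat set \<Rightarrow> quat \<Rightarrow> quat"
  where "H_derivative f G z0 = (THE D. has_H_derivative f G z0 D)"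

text \<open>
  The value of the derivative does not depend on the choice of the sequences: \<open>D\<close> is the
  directional derivative of \<open>f\<close> at \<open>z0\<close> along the real axis.
\<close>

lemma has_H_derivative_real_direction:
  assumes "has_H_derivative f G z0 D"
  shows "((\<lambda>t. (f (z0 + of_real t) - f z0) /\<^sub>R t) \<longlongrightarrow> D) (at 0)"
proof -
  obtain A B \<omega> where z0: "z0 \<in> interior G" and AB: "(\<lambda>k. A k * B k) sums D"
    and eq: "\<And>h. z0 + h \<in> G \<Longrightarrow> f (z0 + h) - f z0 = (\<Sum>k. A k * h * B k) + \<omega> h"
    and lim: "((\<lambda>h. norm (\<omega> h) / norm h) \<longlongrightarrow> 0) (at 0)"
    using assms unfolding has_H_derivative_def by blast
  have of_real: "filterlim (of_real :: real \<Rightarrow> quat) (at 0) (at 0)"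
    using tendsto_of_real [OF tendsto_ident_at [of "0 :: real" UNIV], where 'a = quat]
    by (simp add: filterlim_at eventually_at_filter)
  have "((\<lambda>t. norm (\<omega> (of_real t)) / norm (of_real t :: quat)) \<longlongrightarrow> 0) (at 0)"
    by (rule filterlim_compose [OF lim of_real])
  then have "((\<lambda>t. norm (\<omega> (of_real t) /\<^sub>R t)) \<longlongrightarrow> 0) (at 0)"
    by (simp add: divide_inverse mult.commute)
  then have "((\<lambda>t. D + \<omega> (of_real t) /\<^sub>R t) \<longlongrightarrow> D + 0) (at 0)"
    by (rule tendsto_add [OF tendsto_const tendsto_norm_zero_cancel])
  moreover have "eventually (\<lambda>t. D + \<omega> (of_real t) /\<^sub>R t = (f (z0 + of_real t) - f z0) /\<^sub>R t) (at 0)"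
  proof -
    have "((\<lambda>t::real. z0 + of_real t) \<longlongrightarrow> z0) (at 0)"
      by (auto intro!: tendsto_eq_intros)
    then have "eventually (\<lambda>t::real. z0 + of_real t \<in> interior G) (at 0)"
      using z0 by (intro topological_tendstoD) auto
    moreover have "eventually (\<lambda>t::real. t \<noteq> 0) (at 0)"
      by (simp add: eventually_at_filter)
    ultimately show ?thesis
    proof eventually_elim
      case (elim t)
      have "(\<lambda>k. A k * of_real t * B k) sums (t *\<^sub>R D)"
        using sums_scaleR_right [OF AB, of t] by (simp add: of_real_def)
      then have "f (z0 + of_real t) - f z0 = t *\<^sub>R D + \<omega> (of_real t)"
        using eq [of "of_real t"] elim(1) interior_subset [of G] by (auto simp: sums_iff)
      then show ?case
        using elim(2) by (simp add: scaleR_right_distrib)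
    qed
  qed
  ultimately show ?thesis
    using tendsto_cong by force
qed

lemma has_H_derivative_unique:
  assumes "has_H_derivative f G z0 D" "has_H_derivative f G z0 D'"
  shows "D = D'"
  using tendsto_unique [OF _ assms [THEN has_H_derivative_real_direction]] by simp

end

theory Submission
  imports Defs
begin

text \<open>
  Every real-linear map \<open>L\<close> on the quaternions is a finite sum \<open>h \<mapsto> \<Sum>k. A\<^sub>k h B\<^sub>k\<close>, because
  \<open>4 Re x = x - i x i - j x j - k x k\<close> and the other coordinates are real parts of \<open>-i x\<close>,
  \<open>-j x\<close>, \<open>-k x\<close>. Hence Frechet differentiability implies \<open>H\<close>-differentiability, and the
  \<open>H\<close>-derivative is the value \<open>L 1\<close> of the Frechet derivative. For the sine, \<open>L\<close> is obtained by
  differentiating the power series termwise, and in the direction \<open>1\<close>, which commutes with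
  everything, the termwise derivative is the series of the cosine.
\<close>

text \<open>Unrolled, this is the sum of \<open>x ^ i * h * x ^ (n - 1 - i)\<close> over
  \<open>i < n\<close>, which replaces \<open>n * x ^ (n - 1) * h\<close> when \<open>x\<close> and
  \<open>h\<close> need not commute.\<close>

fun power_deriv :: "nat \<Rightarrow> 'a \<Rightarrow> 'a \<Rightarrow> 'a :: ring_1"
  where
    "power_deriv 0 x h = 0"
  | "power_deriv (Suc n) x h = x * power_deriv n x h + h * x ^ n"

lemma has_derivative_power_deriv:
  fixes x :: "'a :: real_normed_algebra_1"
  shows "((\<lambda>x. x ^ n) has_derivative power_deriv n x) (at x within S)"
proof (induction n)
  case (Suc n)
  then show ?case
    using has_derivative_mult [OF has_derivative_ident Suc] by simp
qed simp

lemma power_deriv_one: "power_deriv (Suc n) x 1 = of_nat (Suc n) * x ^ n"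
proof (induction n)
  case (Suc n)
  have "power_deriv (Suc (Suc n)) x 1 = x * (of_nat (Suc n) * x ^ n) + x ^ Suc n"
    using Suc by simp
  also have "x * (of_nat (Suc n) * x ^ n) = of_nat (Suc n) * x ^ Suc n"
    by (metis mult.assoc mult_of_nat_commute power_Suc)
  finally show ?case
    by (simp add: algebra_simps)
qed simp

text \<open>Each of the \<open>Suc n\<close> summands \<open>x ^ i * h * x ^ (n - i)\<close> has
  norm at most \<open>R ^ n * norm h\<close>. The bound depends on \<open>x\<close> only through
  \<open>R\<close>, as a Weierstrass majorant requires.\<close>

lemma norm_power_deriv_le:
  fixes x :: "'a :: real_normed_algebra_1"
  assumes "norm x \<le> R"
  shows "norm (power_deriv (Suc n) x h) \<le> of_nat (Suc n) * R ^ n * norm h"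
proof (induction n)
  case (Suc n)
  have "0 \<le> R"
    using assms norm_ge_zero order_trans by blast
  have "norm (x * power_deriv (Suc n) x h) \<le> R * (of_nat (Suc n) * R ^ n * norm h)"
    using assms \<open>0 \<le> R\<close> Suc by (intro order_trans [OF norm_mult_ineq] mult_mono) auto
  moreover have "norm (h * x ^ Suc n) \<le> norm h * R ^ Suc n"
    using assms by (intro order_trans [OF norm_mult_ineq] mult_left_mono
        order_trans [OF norm_power_ineq] power_mono) auto
  ultimately have "norm (x * power_deriv (Suc n) x h + h * x ^ Suc n)
      \<le> R * (of_nat (Suc n) * R ^ n * norm h) + norm h * R ^ Suc n"
    by (rule norm_triangle_mono)
  also have "\<dots> = of_nat (Suc (Suc n)) * R ^ Suc n * norm h"
    by (simp add: algebra_simps)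
  finally show ?case
    by simp
qed simp

lemma has_derivative_sin_normed_algebra:
  fixes z :: "'a :: {real_normed_algebra_1, banach}"
  obtains L where "(sin has_derivative L) (at z)" "L 1 = cos z"
proof -
  \<comment> \<open>With this radius, \<open>norm x \<le> R\<close> holds on all of
    \<open>ball z 1\<close>, so the majorant \<open>M\<close> serves every point of that
    ball.\<close>
  define R where "R = norm z + 1"
  define M where "M n = norm (sin_coeff n) * (of_nat n * R ^ (n - 1))" for n
  define T where "T n x h = sin_coeff n *\<^sub>R power_deriv n x h" for n and x h :: 'a
  define L where "L x h = (\<Sum>n. T n x h)" for x h
  have "0 \<le> R"
    by (simp add: R_def add_nonneg_nonneg)
  have "summable (\<lambda>n. M (Suc n))"
  proof (rule summable_comparison_test')
    \<comment> \<open>The factor \<open>Suc n\<close> cancels against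
      \<open>sin_coeff (Suc n)\<close> and leaves the absolute value of \<open>cos_coeff n\<close>,
      so the exponential series at \<open>R\<close> dominates.\<close>
    show "summable (\<lambda>n. inverse (fact n) * R ^ n)"
      by (rule summable_exp)
    show "norm (M (Suc n)) \<le> inverse (fact n) * R ^ n" for n
      using \<open>0 \<le> R\<close>
      by (auto simp: M_def sin_coeff_Suc cos_coeff_def abs_mult field_simps)
  qed
  then have M: "summable M"
    by (simp only: summable_Suc_iff)
  have T_le: "norm (T n x h) \<le> M n * norm h" if "norm x \<le> R" for n x h
  proof (cases n)
    case (Suc m)
    show ?thesis
      using mult_left_mono [OF norm_power_deriv_le [OF that, of m h], of "norm (sin_coeff n)"]
      by (simp add: T_def M_def Suc mult.assoc del: power_deriv.simps)
  qed (simp add: T_def M_def)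
  have T_summable: "summable (\<lambda>n. T n x h)" if "norm x \<le> R" for x h
    using T_le [OF that] by (intro summable_comparison_test' [OF summable_mult2 [OF M]])
  \<comment> \<open>Termwise differentiation needs the derivative series to converge uniformly in
    operator norm. The error is bounded by a tail of \<open>M\<close>, independent of
    \<open>x\<close>, times \<open>norm h\<close>.\<close>
  have tail: "\<forall>\<^sub>F n in sequentially. \<forall>x\<in>ball z 1. \<forall>h.
      norm ((\<Sum>i<n. T i x h) - L x h) \<le> e * norm h" if "e > 0" for e
  proof -
    have "(\<lambda>n. \<Sum>i. M (i + n)) \<longlonglongrightarrow> 0"
      using suminf_exist_split2 [OF M] by blast
    then have "\<forall>\<^sub>F n in sequentially. (\<Sum>i. M (i + n)) < e"
      by (rule order_tendstoD) (rule that)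
    then show ?thesis
    proof (eventually_elim, intro ballI allI)
      fix n x h
      assume n: "(\<Sum>i. M (i + n)) < e" and "x \<in> ball z 1"
      then have x: "norm x \<le> R"
        using norm_triangle_sub [of x z] by (simp add: R_def dist_norm norm_minus_commute)
      have M_n: "summable (\<lambda>i. M (i + n))"
        using M by (rule summable_ignore_initial_segment)
      have "norm ((\<Sum>i<n. T i x h) - L x h) = norm (\<Sum>i. T (i + n) x h)"
        unfolding L_def by (subst suminf_split_initial_segment [OF T_summable [OF x], of _ n]) simp
      also have "\<dots> \<le> (\<Sum>i. M (i + n) * norm h)"
        using T_le [OF x] by (intro norm_suminf_le summable_mult2 M_n)
      also have "\<dots> = (\<Sum>i. M (i + n)) * norm h"
        by (rule suminf_mult2 [OF M_n, symmetric])
      also have "\<dots> \<le> e * norm h"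
        using n by (intro mult_right_mono) auto
      finally show "norm ((\<Sum>i<n. T i x h) - L x h) \<le> e * norm h" .
    qed
  qed
  obtain g where g: "\<forall>x\<in>ball z 1. (\<lambda>n. sin_coeff n *\<^sub>R x ^ n) sums g x
      \<and> (g has_derivative L x) (at x within ball z 1)"
  proof -
    have "\<exists>g. \<forall>x\<in>ball z 1. (\<lambda>n. sin_coeff n *\<^sub>R x ^ n) sums g x
      \<and> (g has_derivative L x) (at x within ball z 1)"
    proof (rule has_derivative_series [where l = "sin z" and x = z])
      show "((\<lambda>x. sin_coeff n *\<^sub>R x ^ n) has_derivative T n x) (at x within ball z 1)" for n x
        unfolding T_def by (intro has_derivative_scaleR_right has_derivative_power_deriv)
    qed (use tail sin_converges in auto)
    then show ?thesis
      using that by blast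
  qed
  \<comment> \<open>So far \<open>g\<close> is only some sum function, with a derivative within the
    ball. Openness of the ball and uniqueness of sums transfer this to \<open>sin\<close> at
    \<open>z\<close>.\<close>
  have "(g has_derivative L z) (at z)"
    using g by (metis at_within_open centre_in_ball open_ball zero_less_one)
  moreover have "g x = sin x" if "x \<in> ball z 1" for x
    using g that sin_converges sums_unique2 by blast
  ultimately have "(sin has_derivative L z) (at z)"
    using has_derivative_transform_within_open [OF _ open_ball, of g "L z" z UNIV z 1 sin] by simp
  moreover have "L z 1 = cos z"
  proof -
    \<comment> \<open>The denominator in \<open>sin_coeff (Suc n)\<close> cancels against
      \<open>Suc n\<close> from \<open>power_deriv_one\<close>. The later shift of the index costs
      nothing because \<open>T 0 z 1\<close> vanishes.\<close>
    have "T (Suc n) z 1 = cos_coeff n *\<^sub>R z ^ n" for n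
    proof -
      have "T (Suc n) z 1 = (sin_coeff (Suc n) * real (Suc n)) *\<^sub>R z ^ n"
        unfolding T_def power_deriv_one
        by (simp only: scaleR_conv_of_real of_real_mult of_real_of_nat_eq mult.assoc)
      then show ?thesis
        by (simp add: sin_coeff_Suc del: of_nat_Suc)
    qed
    then have "(\<lambda>n. T (Suc n) z 1) sums cos z"
      using cos_converges by simp
    then have "(\<lambda>n. T n z 1) sums cos z"
      by (subst (asm) sums_Suc_iff) (simp add: T_def)
    then show ?thesis
      by (simp add: L_def sums_iff)
  qed
  ultimately show ?thesis
    by (rule that)
qed

lemma quat_linear_sums:
  assumes "linear L"
  obtains A B :: "nat \<Rightarrow> quat" where "\<And>h. (\<lambda>k. A k * h * B k) sums L h"
proof -
  let ?i = "Quat 0 1 0 0" and ?j = "Quat 0 0 1 0" and ?k = "Quat 0 0 0 1"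
  \<comment> \<open>The pairs stand for \<open>e\<close> and its conjugate \<open>e'\<close>; the coordinate of \<open>h\<close> along \<open>e\<close> is \<open>qRe (e' * h)\<close>.\<close>
  define xs where "xs = concat (map (\<lambda>(e, e'). map (\<lambda>(d, d'). (d * e', (1/4) *\<^sub>R (d' * L e)))
      [(1, 1), (?i, - ?i), (?j, - ?j), (?k, - ?k)])
      [(1, 1), (?i, - ?i), (?j, - ?j), (?k, - ?k)])"
  define A where "A k = (if k < length xs then fst (xs ! k) else 0)" for k
  define B where "B k = (if k < length xs then snd (xs ! k) else 0)" for k
  \<comment> \<open>Used with \<open>x = e' * h\<close> and \<open>w = L e\<close>, this splits each
    of the four coordinate terms of \<open>L h\<close> into four products, giving the sixteen
    entries of \<open>xs\<close>.\<close>
  have real_part: "x * ((1/4) *\<^sub>R w) + ?i * x * ((1/4) *\<^sub>R (- ?i * w)) + ?j * x * ((1/4) *\<^sub>R (- ?j * w))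
      + ?k * x * ((1/4) *\<^sub>R (- ?k * w)) = qRe x *\<^sub>R w" for x w
    by (simp add: quat_eq_iff algebra_simps)
  have "(\<lambda>k. A k * h * B k) sums L h" for h
  proof -
    have "h = qRe h *\<^sub>R 1 + qRe (- ?i * h) *\<^sub>R ?i + qRe (- ?j * h) *\<^sub>R ?j + qRe (- ?k * h) *\<^sub>R ?k"
      by (simp add: quat_eq_iff)
    then have "L h = L (qRe h *\<^sub>R 1 + qRe (- ?i * h) *\<^sub>R ?i + qRe (- ?j * h) *\<^sub>R ?j + qRe (- ?k * h) *\<^sub>R ?k)"
      by (rule arg_cong)
    also have "\<dots> = qRe h *\<^sub>R L 1 + qRe (- ?i * h) *\<^sub>R L ?i + qRe (- ?j * h) *\<^sub>R L ?j
        + qRe (- ?k * h) *\<^sub>R L ?k"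
      by (simp only: linear_add [OF assms] linear_scale [OF assms])
    also have "\<dots> = (\<Sum>(a, b)\<leftarrow>xs. a * h * b)"
      unfolding real_part [symmetric] by (simp add: xs_def mult.assoc add.assoc)
    also have "\<dots> = (\<Sum>k<length xs. A k * h * B k)"
      by (auto simp: sum_list_sum_nth A_def B_def case_prod_beta atLeast0LessThan intro: sum.cong)
    finally show ?thesis
      using sums_finite [of "{..<length xs}" "\<lambda>k. A k * h * B k"] by (simp add: A_def)
  qed
  then show ?thesis
    by (rule that)
qed

text \<open>The Frechet remainder serves as \<open>\<omega>\<close>, and setting
  \<open>h = 1\<close> in the two-sided expansion of \<open>L\<close> evaluates the sum of the
  \<open>A k * B k\<close>.\<close>

lemma has_H_derivative_if_has_derivative:
  assumes f: "(f has_derivative L) (at z)" and "z \<in> interior G"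
  shows "has_H_derivative f G z (L 1)"
proof -
  obtain A B where AB: "\<And>h. (\<lambda>k. A k * h * B k) sums L h"
    using quat_linear_sums [OF has_derivative_linear [OF f]] by blast
  define \<omega> where "\<omega> h = f (z + h) - f z - L h" for h
  have "(\<lambda>k. A k * B k) sums L 1"
    using AB [of 1] by simp
  moreover have "summable (\<lambda>k. A k * h * B k) \<and>
      f (z + h) - f z = (\<Sum>k. A k * h * B k) + \<omega> h" for h
    using AB [of h] by (simp add: sums_iff \<omega>_def)
  moreover have "((\<lambda>h. norm (\<omega> h) / norm h) \<longlongrightarrow> 0) (at 0)"
    using f by (simp add: has_derivative_at \<omega>_def)
  ultimately show ?thesis
    using \<open>z \<in> interior G\<close> unfolding has_H_derivative_def by blast
qed

theorem proposition2p5: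
  fixes z :: quat
  shows "H_differentiable sin UNIV z \<and> H_derivative sin UNIV z = cos z"
proof -
  obtain L where "(sin has_derivative L) (at z)" "L 1 = cos z"
    using has_derivative_sin_normed_algebra .
  then have "has_H_derivative sin UNIV z (cos z)"
    using has_H_derivative_if_has_derivative [of sin L z UNIV] by simp
  then show ?thesis
    unfolding H_differentiable_def H_derivative_def
    by (blast intro: the_equality has_H_derivative_unique)
qed

end
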